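(* Let $n\ge 1$ be an integer. If $16\mid n$ then $G_n(x_0x_1x_{n/2})^{\mathrm{ab}}\cong G_n(x_0x_1x_{n/4})^{\mathrm{ab}}\cong\mathbb{Z}_{2^{n/2}-1}$.
   Context: For an element $w=w(x_0,\dots,x_{n-1})$ of the free group on $x_0,\dots,x_{n-1}$, the cyclically presented group $G_n(w)$ is the group with presentation $\langle x_0,\dots,x_{n-1}\mid w(x_i,x_{i+1},\dots,x_{i+n-1})\ (0\le i<n)\rangle$, subscripts taken mod $n$. $G^{\mathrm{ab}}$ denotes the abelianization of $G$, and $\mathbb{Z}_m=\mathbb{Z}/m\mathbb{Z}$. *)

theory Defs
  imports "HOL-Algebra.Algebra"
begin

section \<open>Free groups\<close>

text \<open>A letter \<open>(a, True)\<close> stands for the generator \<open>a\<close>, and \<open>(a, False)\<close> for its formal inverse.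
  The free group on \<open>S\<close> consists of the freely reduced words in these letters.\<close>

definition inv_letter :: "'a \<times> bool \<Rightarrow> 'a \<times> bool" where
  "inv_letter l = (fst l, \<not> snd l)"

definition reduced :: "('a \<times> bool) list \<Rightarrow> bool" where
  "reduced w \<longleftrightarrow> successively (\<lambda>l m. m \<noteq> inv_letter l) w"

fun push_letter :: "'a \<times> bool \<Rightarrow> ('a \<times> bool) list \<Rightarrow> ('a \<times> bool) list" where
  "push_letter l [] = [l]"
| "push_letter l (m # w) = (if m = inv_letter l then w else l # m # w)"

definition reduce :: "('a \<times> bool) list \<Rightarrow> ('a \<times> bool) list" where
  "reduce w = foldr push_letter w []"

definition free_group :: "'a set \<Rightarrow> ('a \<times> bool) list monoid" where
  "free_group S =
    \<lparr>carrier = {w. reduced w \<and> fst ` set w \<subseteq> S},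
     monoid.mult = (\<lambda>u v. reduce (u @ v)),
     one = []\<rparr>"

definition free_gen :: "'a \<Rightarrow> ('a \<times> bool) list" where
  "free_gen a = [(a, True)]"

lemma inv_letter_inv_letter [simp]: "inv_letter (inv_letter l) = l"
  by (simp add: inv_letter_def)

lemma fst_inv_letter [simp]: "fst (inv_letter l) = fst l"
  by (simp add: inv_letter_def)

lemma inv_letter_neq [simp]: "inv_letter l \<noteq> l" "l \<noteq> inv_letter l"
  by (simp_all add: inv_letter_def prod_eq_iff)

lemma reduced_Nil [simp]: "reduced []"
  by (simp add: reduced_def)

lemma reduced_push: "reduced w \<Longrightarrow> reduced (push_letter l w)"
  by (cases w) (auto simp: reduced_def successively_Cons)

lemma reduced_foldr_push: "reduced v \<Longrightarrow> reduced (foldr push_letter u v)"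
  by (induction u) (auto intro: reduced_push)

lemma foldr_push_reduced: "reduced w \<Longrightarrow> foldr push_letter w [] = w"
proof (induction w)
  case (Cons l w)
  then show ?case by (cases w) (auto simp: reduced_def)
qed simp

lemma push_push_inv: "reduced w \<Longrightarrow> push_letter l (push_letter (inv_letter l) w) = w"
proof (cases w)
  case (Cons m v)
  moreover assume "reduced w"
  ultimately show ?thesis
    by (cases v) (auto simp: reduced_def)
qed simp

lemma foldr_push_push:
  assumes "reduced w"
  shows "foldr push_letter (push_letter l u) w = push_letter l (foldr push_letter u w)"
  using assms by (cases u) (auto simp: push_push_inv reduced_foldr_push)

lemma foldr_push_foldr_push:
  assumes "reduced w"
  shows "foldr push_letter (foldr push_letter u v) w = foldr push_letter u (foldr push_letter v w)"
  by (induction u) (simp_all add: foldr_push_push assms)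

lemma set_push: "set (push_letter l w) \<subseteq> insert l (set w)"
  by (cases w) auto

lemma set_foldr_push: "set (foldr push_letter u v) \<subseteq> set u \<union> set v"
proof (induction u)
  case (Cons l u)
  then show ?case using set_push[of l "foldr push_letter u v"] by auto
qed simp

lemma carrier_free_group: "w \<in> carrier (free_group S) \<longleftrightarrow> reduced w \<and> fst ` set w \<subseteq> S"
  by (simp add: free_group_def)

lemma one_free_group [simp]: "\<one>\<^bsub>free_group S\<^esub> = []"
  by (simp add: free_group_def)

lemma mult_free_group:
  "reduced v \<Longrightarrow> u \<otimes>\<^bsub>free_group S\<^esub> v = foldr push_letter u v"
  by (simp add: free_group_def reduce_def foldr_push_reduced)

lemma foldr_push_left_inverse:
  "reduced w \<Longrightarrow> foldr push_letter (rev (map inv_letter w)) w = []"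
proof (induction w)
  case (Cons l w)
  moreover have "reduced w"
    using Cons.prems by (cases w) (auto simp: reduced_def)
  ultimately show ?case by simp
qed simp

lemma reduced_rev_map_inv: "reduced w \<Longrightarrow> reduced (rev (map inv_letter w))"
  unfolding reduced_def successively_rev successively_map
  by (erule successively_mono) (metis inv_letter_inv_letter)

theorem group_free_group: "group (free_group S)"
proof (rule groupI)
  fix u v assume uv: "u \<in> carrier (free_group S)" "v \<in> carrier (free_group S)"
  then show "u \<otimes>\<^bsub>free_group S\<^esub> v \<in> carrier (free_group S)"
    using set_foldr_push[of u v]
    by (simp add: carrier_free_group mult_free_group reduced_foldr_push) blast
next
  fix u v w
  assume "u \<in> carrier (free_group S)" "v \<in> carrier (free_group S)" "w \<in> carrier (free_group S)"
  then show "u \<otimes>\<^bsub>free_group S\<^esub> v \<otimes>\<^bsub>free_group S\<^esub> w = u \<otimes>\<^bsub>free_group S\<^esub> (v \<otimes>\<^bsub>free_group S\<^esub> w)"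
    by (simp add: carrier_free_group mult_free_group reduced_foldr_push foldr_push_foldr_push)
next
  fix u assume u: "u \<in> carrier (free_group S)"
  then have "rev (map inv_letter u) \<in> carrier (free_group S)"
    by (auto simp: carrier_free_group reduced_rev_map_inv)
  with u show "\<exists>y\<in>carrier (free_group S). y \<otimes>\<^bsub>free_group S\<^esub> u = \<one>\<^bsub>free_group S\<^esub>"
    by (intro bexI[of _ "rev (map inv_letter u)"])
      (auto simp: carrier_free_group mult_free_group foldr_push_left_inverse)
qed (auto simp: carrier_free_group mult_free_group)

lemma free_gen_closed: "a \<in> S \<Longrightarrow> free_gen a \<in> carrier (free_group S)"
  by (simp add: carrier_free_group free_gen_def reduced_def)


section \<open>Presentations and abelianization\<close>

definition normal_closure :: "('a, 'b) monoid_scheme \<Rightarrow> 'a set \<Rightarrow> 'a set" where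
  "normal_closure G R = \<Inter>{N. N \<lhd> G \<and> R \<subseteq> N}"

definition presented_group :: "'a set \<Rightarrow> ('a \<times> bool) list set \<Rightarrow> ('a \<times> bool) list set monoid" where
  "presented_group S R = free_group S Mod normal_closure (free_group S) R"

definition abelianization :: "('a, 'b) monoid_scheme \<Rightarrow> 'a set monoid" where
  "abelianization G = G Mod derived G (carrier G)"

lemma (in group) normal_closure_normal:
  assumes "R \<subseteq> carrier G"
  shows "normal_closure G R \<lhd> G"
proof -
  have ne: "carrier G \<in> {N. N \<lhd> G \<and> R \<subseteq> N}"
    using assms by (auto intro!: normal_invI subgroup_self)
  have "subgroup (\<Inter>{N. N \<lhd> G \<and> R \<subseteq> N}) G"
    using ne by (intro subgroups_Inter) (auto intro: normal_imp_subgroup)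
  then show ?thesis
    unfolding normal_closure_def
    by (rule normal_invI) (auto intro: normal.inv_op_closed2)
qed

lemma group_presented_group:
  assumes "R \<subseteq> carrier (free_group S)"
  shows "group (presented_group S R)"
  unfolding presented_group_def
  by (intro normal.factorgroup_is_group group.normal_closure_normal group_free_group assms)


section \<open>Cyclically presented groups\<close>

text \<open>\<open>shift_word n i w\<close> is \<open>w(x\<^sub>i, x\<^sub>i\<^sub>+\<^sub>1, \<dots>, x\<^sub>i\<^sub>+\<^sub>n\<^sub>-\<^sub>1)\<close> with subscripts mod \<open>n\<close>.
  This substitution permutes the generators, so it preserves freely reduced words and
  no further reduction is needed.\<close>

definition shift_word :: "nat \<Rightarrow> nat \<Rightarrow> (nat \<times> bool) list \<Rightarrow> (nat \<times> bool) list" where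
  "shift_word n i w = map (\<lambda>(j, b). ((i + j) mod n, b)) w"

definition cyc_presented_group :: "nat \<Rightarrow> (nat \<times> bool) list \<Rightarrow> (nat \<times> bool) list set monoid" where
  "cyc_presented_group n w = presented_group {..<n} ((\<lambda>i. shift_word n i w) ` {..<n})"

lemma shift_word_closed:
  assumes "w \<in> carrier (free_group {..<n})"
  shows "shift_word n i w \<in> carrier (free_group {..<n})"
proof -
  have inj: "j = k" if "(i + j) mod n = (i + k) mod n" "j < n" "k < n" for j k
  proof (rule ccontr)
    assume "j \<noteq> k"
    then consider "j < k" | "k < j" by linarith
    then show False
    proof cases
      case 1
      then have "n dvd k - j"
        using that(1) mod_eq_dvd_iff_nat[of "i + j" "i + k" n] by simp
      with 1 that show False by (auto dest: dvd_imp_le)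
    next
      case 2
      then have "n dvd j - k"
        using that(1) mod_eq_dvd_iff_nat[of "i + k" "i + j" n] by simp
      with 2 that show False by (auto dest: dvd_imp_le)
    qed
  qed
  have letters: "fst l < n" if "l \<in> set w" for l
    using assms that by (auto simp: carrier_free_group)
  have "successively (\<lambda>l m. m \<noteq> inv_letter l) (map (\<lambda>(j, b). ((i + j) mod n, b)) w)"
    unfolding successively_map
  proof (rule successively_mono)
    show "successively (\<lambda>l m. m \<noteq> inv_letter l) w"
      using assms by (simp add: carrier_free_group reduced_def)
  next
    fix l m assume lm: "l \<in> set w" "m \<in> set w" "m \<noteq> inv_letter l"
    show "(case m of (j, b) \<Rightarrow> ((i + j) mod n, b)) \<noteq>
        inv_letter (case l of (j, b) \<Rightarrow> ((i + j) mod n, b))"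
      using lm(3) inj[of "fst m" "fst l"] letters[OF lm(1)] letters[OF lm(2)]
      by (cases l; cases m) (auto simp: inv_letter_def)
  qed
  moreover have "fst ` set (shift_word n i w) \<subseteq> {..<n}"
    using letters by (force simp: shift_word_def)
  ultimately show ?thesis
    by (simp add: carrier_free_group reduced_def shift_word_def)
qed

lemma group_cyc_presented_group:
  assumes "w \<in> carrier (free_group {..<n})"
  shows "group (cyc_presented_group n w)"
  unfolding cyc_presented_group_def
  using assms by (intro group_presented_group) (auto intro: shift_word_closed)

text \<open>The relator \<open>x\<^sub>a x\<^sub>b x\<^sub>c\<close>, as an element of the free group on \<open>x\<^sub>0, \<dots>, x\<^sub>n\<^sub>-\<^sub>1\<close>.\<close>

definition pos_word3 :: "nat \<Rightarrow> nat \<Rightarrow> nat \<Rightarrow> nat \<Rightarrow> (nat \<times> bool) list" where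
  "pos_word3 n a b c =
    free_gen a \<otimes>\<^bsub>free_group {..<n}\<^esub> free_gen b \<otimes>\<^bsub>free_group {..<n}\<^esub> free_gen c"

end

theory Submission
  imports Defs "HOL-Computational_Algebra.Polynomial" "HOL-Number_Theory.Cong"
begin

text \<open>The abelianization of \<open>G\<^sub>n(w)\<close> is the additive group of \<open>\<int>[t]/(t\<^sup>n - 1, f)\<close>, where \<open>f\<close> is the
  exponent polynomial of \<open>w\<close>; here \<open>f = 1 + t + s\<close> with \<open>s = t\<^sup>m\<close> and \<open>m = n/2\<close> or \<open>m = n/4\<close>. If \<open>t\<close> is
  congruent to an integer \<open>r\<close> modulo this ideal, the quotient is cyclic. For \<open>m = n/2\<close>, \<open>s\<^sup>2 = 1\<close> gives
  \<open>t\<^sup>2 = -2t\<close>, and \<open>t\<close> is a unit, so \<open>t = -2\<close>. For \<open>m = n/4\<close>, \<open>s\<^sup>4 = 1\<close> and \<open>t = -(1 + s)\<close> a unit force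
  \<open>(s - 1)(s\<^sup>2 + 1) = 0\<close>, whence \<open>t\<^sup>4 = 6 + 10s\<^sup>2\<close>. On the factor \<open>s = 1\<close> this is \<open>16\<close> and on \<open>s\<^sup>2 = -1\<close> it
  is \<open>-4\<close>, so \<open>s\<close> becomes \<open>1\<close> modulo \<open>16\<^sup>k - 1\<close> and \<open>(-4)\<^sup>k\<close> modulo \<open>16\<^sup>k + 1\<close>, where \<open>n = 16k\<close>;
  the two factors are glued because \<open>2\<close> is invertible.\<close>

section \<open>Two ideal computations\<close>

lemma dvd_power_diff:
  fixes x y :: "'a::comm_ring_1"
  shows "x - y dvd x ^ n - y ^ n"
  by (simp add: power_diff_sumr2)

text \<open>Working in an arbitrary ideal lets the computations be applied directly to an
  annihilator in \<open>int poly\<close>, without forming a quotient ring.\<close>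

locale ring_ideal =
  fixes I :: "'a::comm_ring_1 set"
  assumes zero_mem: "0 \<in> I"
    and diff_mem: "\<And>x y. x \<in> I \<Longrightarrow> y \<in> I \<Longrightarrow> x - y \<in> I"
    and mult_mem: "\<And>x y. x \<in> I \<Longrightarrow> x * y \<in> I"
begin

lemma add_mem: "x \<in> I \<Longrightarrow> y \<in> I \<Longrightarrow> x + y \<in> I"
  using diff_mem[of x "0 - y"] diff_mem[of 0 y] zero_mem by simp

lemma mult_mem_left: "y \<in> I \<Longrightarrow> x * y \<in> I"
  using mult_mem[of y x] by (simp add: mult.commute)

lemma dvd_mem: "x \<in> I \<Longrightarrow> x dvd y \<Longrightarrow> y \<in> I"
  by (auto simp: mult_mem elim!: dvdE)

text \<open>Modulo \<open>I\<close>, \<open>t\<close> is a unit with inverse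
  \<open>t ^ (n - 1)\<close>.\<close>

lemma cancel_unit:
  assumes "t ^ n - 1 \<in> I" "n > 0" "t * x \<in> I"
  shows "x \<in> I"
proof -
  obtain n' where "n = Suc n'" using \<open>n > 0\<close> by (cases n) auto
  then have eq: "x = t ^ n' * (t * x) - (t ^ n - 1) * x"
    by (simp add: algebra_simps)
  show ?thesis
    by (subst eq) (rule diff_mem[OF mult_mem_left[OF assms(3)] mult_mem[OF assms(1)]])
qed

lemma cancel_unit_power:
  assumes "t ^ n - 1 \<in> I" "n > 0" "t ^ j * x \<in> I"
  shows "x \<in> I"
  using assms(3) by (induction j) (auto simp: mult.assoc intro: cancel_unit[OF assms(1,2)])

lemma half_shift:
  assumes t: "t ^ (2 * m) - 1 \<in> I" and f: "1 + t + t ^ m \<in> I" and "even m" "m > 0"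
  shows "t - of_int (-2) \<in> I" "2 ^ m - 1 \<in> I"
proof -
  define f where "f = 1 + t + t ^ m"
  \<comment> \<open>Squaring \<open>t ^ m = f - (1 + t)\<close> and subtracting \<open>1\<close>
    leaves \<open>t * (t + 2)\<close> modulo \<open>f\<close>.\<close>
  have eq: "t * (t + 2) = (t ^ (2 * m) - 1) - f * (f - 2 * (1 + t))"
    unfolding f_def mult_2[of m] power_add by (simp add: algebra_simps)
  have "t * (t + 2) \<in> I"
    unfolding eq using diff_mem[OF t mult_mem[OF f]] by (simp add: f_def)
  then have t2: "t + 2 \<in> I"
    using cancel_unit[OF t] \<open>m > 0\<close> by simp
  then show "t - of_int (-2) \<in> I" by simp
  have "t + 2 dvd t ^ m - (-2) ^ m"
    using dvd_power_diff[of t "-2" m] by simp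
  then have "t ^ m - 2 ^ m \<in> I"
    using dvd_mem[OF t2] \<open>even m\<close> by simp
  from diff_mem[OF diff_mem[OF f t2] this] show "2 ^ m - 1 \<in> I"
    by (simp add: algebra_simps)
qed

text \<open>Multiplying by \<open>s\<^sup>2 + 1\<close> isolates the factor \<open>s = 1\<close>,
  multiplying by \<open>s - 1\<close> the factor \<open>s\<^sup>2 = -1\<close>. The doubled equation
  for \<open>y\<close> transfers to any ring without division.\<close>

lemma quarter_shift:
  fixes k :: nat and y :: int
  assumes t: "t ^ (16 * k) - 1 \<in> I" and f: "1 + t + t ^ (4 * k) \<in> I" and "k > 0"
    and y: "2 * y = 16 ^ k - (-4) ^ k"
  shows "t - of_int (- (1 + 16 ^ k + (16 ^ k - 1) * y)) \<in> I" "16 ^ k * 16 ^ k - 1 \<in> I"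
proof -
  define s where "s = t ^ (4 * k)"
  define M c :: 'a where "M = 16 ^ k" and "c = (-4) ^ k"
  define q where "q = (s - 1) * (s\<^sup>2 + 1)"
  define w where "w = 6 + 10 * s\<^sup>2"
  have f': "1 + t + s \<in> I" using f by (simp add: s_def)
  have cc: "c * c = M"
    by (simp add: c_def M_def flip: power_mult_distrib)
  have yM: "2 * of_int y = M - c"
    using arg_cong[OF y, of "of_int :: int \<Rightarrow> 'a"] by (simp add: M_def c_def)
  have s4: "s ^ 4 - 1 \<in> I"
    using t by (simp add: s_def mult.commute flip: power_mult)
  have unit: "x \<in> I" if "t ^ j * x \<in> I" for x j
    using cancel_unit_power[OF t _ that] \<open>k > 0\<close> by simp
  \<comment> \<open>\<open>(1 + s) * q\<close> is \<open>s ^ 4 - 1\<close>.\<close>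
  have eq: "t * q = (1 + t + s) * q - (s ^ 4 - 1)"
    by (simp add: q_def algebra_simps eval_nat_numeral)
  have "t * q \<in> I"
    by (subst eq) (rule diff_mem[OF mult_mem[OF f'] s4])
  then have q: "q \<in> I"
    using unit[of 1 q] by simp
  \<comment> \<open>Factor \<open>t ^ 4 - (1 + s) ^ 4\<close>; the remainder
    \<open>(1 + s) ^ 4 - w\<close> is \<open>4 * q + (s ^ 4 - 1)\<close>.\<close>
  have eq: "t ^ 4 - w = (1 + t + s) * ((t - (1 + s)) * (t\<^sup>2 + (1 + s)\<^sup>2)) + (4 * q + (s ^ 4 - 1))"
    by (simp add: q_def w_def algebra_simps eval_nat_numeral)
  have t4: "t ^ 4 - w \<in> I"
    by (subst eq) (rule add_mem[OF mult_mem[OF f'] add_mem[OF mult_mem_left[OF q] s4]])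
  \<comment> \<open>The unit \<open>t ^ 4\<close> is congruent to \<open>w\<close>, which is twice
    \<open>3 + 5 * s\<^sup>2\<close>; so \<open>2\<close> is a unit too.\<close>
  have two: "x \<in> I" if "2 * x \<in> I" for x
  proof -
    have eq: "t ^ 4 * x = (t ^ 4 - w) * x + (3 + 5 * s\<^sup>2) * (2 * x)"
      by (simp add: w_def algebra_simps)
    have "t ^ 4 * x \<in> I"
      by (subst eq) (rule add_mem[OF mult_mem[OF t4] mult_mem_left[OF that]])
    then show ?thesis by (rule unit)
  qed
  have "t ^ 4 - w dvd (t ^ 4) ^ k - w ^ k" by (rule dvd_power_diff)
  then have sw: "s - w ^ k \<in> I"
    using dvd_mem[OF t4] by (simp add: s_def power_mult)
  \<comment> \<open>Where \<open>s = 1\<close>, \<open>w\<close> is \<open>16\<close>, so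
    \<open>s = w ^ k\<close> is also \<open>M\<close>.\<close>
  have A: "(s\<^sup>2 + 1) * (M - 1) \<in> I"
  proof -
    have "(s\<^sup>2 + 1) * (w - 16) = 10 * (s ^ 4 - 1)"
      by (simp add: w_def algebra_simps eval_nat_numeral)
    moreover have "(s\<^sup>2 + 1) * (w - 16) dvd (s\<^sup>2 + 1) * (w ^ k - M)"
      unfolding M_def by (intro mult_dvd_mono dvd_power_diff dvd_refl)
    ultimately have M: "(s\<^sup>2 + 1) * (w ^ k - M) \<in> I"
      using dvd_mem[OF mult_mem_left[OF s4]] by metis
    have eq: "(s\<^sup>2 + 1) * (M - 1) =
        q - (s\<^sup>2 + 1) * (s - w ^ k) - (s\<^sup>2 + 1) * (w ^ k - M)"
      by (simp add: q_def algebra_simps)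
    show ?thesis
      by (subst eq) (rule diff_mem[OF diff_mem[OF q mult_mem_left[OF sw]] M])
  qed
  \<comment> \<open>Where \<open>s\<^sup>2 = -1\<close>, \<open>w\<close> is \<open>-4\<close>, so
    \<open>s = w ^ k\<close> is \<open>c\<close>.\<close>
  have B: "(s - 1) * (s - c) \<in> I"
  proof -
    have "(s - 1) * (w - (-4)) = 10 * q"
      by (simp add: w_def q_def algebra_simps)
    moreover have "(s - 1) * (w - (-4)) dvd (s - 1) * (w ^ k - c)"
      unfolding c_def by (intro mult_dvd_mono dvd_power_diff dvd_refl)
    ultimately have c: "(s - 1) * (w ^ k - c) \<in> I"
      using dvd_mem[OF mult_mem_left[OF q]] by metis
    have eq: "(s - 1) * (s - c) = (s - 1) * (s - w ^ k) + (s - 1) * (w ^ k - c)"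
      by (simp add: algebra_simps)
    show ?thesis
      by (subst eq) (rule add_mem[OF mult_mem_left[OF sw] c])
  qed
  \<comment> \<open>By B, on this factor \<open>s\<^sup>2\<close> is \<open>c * c = M\<close>, yet
    it is also \<open>-1\<close>.\<close>
  have eq: "(M + 1) * (s - 1) = q - (s - 1) * (s - c) * (s + c)"
    by (simp add: q_def algebra_simps power2_eq_square flip: cc)
  have C: "(M + 1) * (s - 1) \<in> I"
    by (subst eq) (rule diff_mem[OF q mult_mem[OF B]])
  \<comment> \<open>The two factors are glued by
    \<open>(s\<^sup>2 + 1) - (s + 1) * (s - 1) = 2\<close>.\<close>
  have eq: "2 * (M * M - 1) = (M + 1) * ((s\<^sup>2 + 1) * (M - 1)) - (M - 1) * (s + 1) * ((M + 1) * (s - 1))"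
    by (simp add: algebra_simps power2_eq_square)
  have N: "M * M - 1 \<in> I"
    by (rule two, subst eq) (rule diff_mem[OF mult_mem_left[OF A] mult_mem_left[OF C]])
  then show "16 ^ k * 16 ^ k - 1 \<in> I" by (simp add: M_def)
  \<comment> \<open>Eliminating \<open>s\<^sup>2\<close> between A and B, then subtracting a
    multiple of C, leaves twice this linear relation.\<close>
  define d where "d = (M - 1) - (1 + c) * (s - 1)"
  have eq: "2 * d = (s\<^sup>2 + 1) * (M - 1) - (M - 1) * ((s - 1) * (s - c)) - (1 + c) * ((M + 1) * (s - 1))"
    by (simp add: d_def algebra_simps power2_eq_square)
  have d: "d \<in> I"
    by (rule two, subst eq) (rule diff_mem[OF diff_mem[OF A mult_mem_left[OF B]] mult_mem_left[OF C]])
  \<comment> \<open>Multiplying \<open>d\<close> by \<open>1 - c\<close> turns its coefficient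
    \<open>1 + c\<close> into \<open>1 - M\<close>, which adds up with the \<open>M + 1\<close> of C
    to \<open>2\<close>.\<close>
  have "2 * (s - (M + (M - 1) * of_int y)) = 2 * s - 2 * M - (M - 1) * (2 * of_int y)"
    by (simp add: algebra_simps)
  also have "\<dots> = (M + 1) * (s - 1) - (1 - c) * d - (M * M - 1)"
    unfolding yM by (simp add: d_def algebra_simps flip: cc)
  finally have eq: "2 * (s - (M + (M - 1) * of_int y)) = \<dots>" .
  have "s - (M + (M - 1) * of_int y) \<in> I"
    by (rule two, subst eq) (rule diff_mem[OF diff_mem[OF C mult_mem_left[OF d]] N])
  from diff_mem[OF f' this] show "t - of_int (- (1 + 16 ^ k + (16 ^ k - 1) * y)) \<in> I"
    by (simp add: M_def algebra_simps)
qed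

end

text \<open>The number \<open>16\<^sup>k + (16\<^sup>k - 1) y\<close> is the Chinese remainder solution of \<open>s \<equiv> 1\<close> modulo
  \<open>16\<^sup>k - 1\<close> and \<open>s \<equiv> (-4)\<^sup>k\<close> modulo \<open>16\<^sup>k + 1\<close>, and \<open>r = -(1 + s)\<close>.\<close>

lemma quarter_shift_root:
  fixes k :: nat and y :: int
  assumes y: "2 * y = 16 ^ k - (-4) ^ k"
    and "k > 0"
  defines "r \<equiv> - (1 + 16 ^ k + (16 ^ k - 1) * y)"
  shows "16 ^ k * 16 ^ k - 1 dvd 1 + r + r ^ (4 * k)"
    and "16 ^ k * 16 ^ k - 1 dvd r ^ (16 * k) - 1"
proof -
  define M c :: int where "M = 16 ^ k" and "c = (-4) ^ k"
  define s where "s = M + (M - 1) * y"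
  have cc: "c * c = M"
    by (simp add: c_def M_def flip: power_mult_distrib)
  have yM: "2 * y = M - c" using y by (simp add: M_def c_def)
  have r: "r = - (1 + s)" by (simp add: r_def s_def M_def)
  have s: "1 + r + r ^ (4 * k) = (r ^ 4) ^ k - s"
    by (simp add: r power_mult)
  have "M - 1 dvd (r ^ 4) ^ k - s"
  proof -
    \<comment> \<open>Modulo \<open>M - 1\<close>, \<open>s\<close> is \<open>1\<close>, so
      \<open>r\<close> is \<open>-2\<close> and \<open>r ^ 4\<close> is \<open>16\<close>.\<close>
    have r2: "M - 1 dvd r - (-2)"
      by (rule dvdI[of _ _ "- 1 - y"]) (simp add: r s_def algebra_simps)
    have "r ^ 4 - (-2) ^ 4 dvd (r ^ 4) ^ k - ((-2) ^ 4) ^ k" by (rule dvd_power_diff)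
    then have "M - 1 dvd (r ^ 4) ^ k - M"
      using dvd_trans[OF r2 dvd_power_diff[of r "-2" 4]] by (auto simp: M_def intro: dvd_trans)
    moreover have "(r ^ 4) ^ k - s = ((r ^ 4) ^ k - M) - (M - 1) * y"
      by (simp add: s_def)
    ultimately show ?thesis by (metis dvd_diff dvd_triv_left)
  qed
  moreover have s2: "M + 1 dvd s\<^sup>2 + 1" and "M + 1 dvd (r ^ 4) ^ k - s"
  proof -
    have "s - c = (M + 1) * y"
      using yM by (simp add: s_def algebra_simps)
    then have sc: "M + 1 dvd s - c" by simp
    have "s\<^sup>2 + 1 = (s - c) * (s + c) + (M + 1)"
      by (simp add: algebra_simps power2_eq_square cc)
    then show s2: "M + 1 dvd s\<^sup>2 + 1" using sc by (metis dvd_add dvd_mult2 dvd_refl)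
    \<comment> \<open>The Sophie Germain factorization of \<open>u ^ 4 + 4\<close> at
      \<open>u = 1 + s\<close>.\<close>
    moreover have "r ^ 4 - (-4) = (s\<^sup>2 + 1) * (s\<^sup>2 + 4 * s + 5)"
      by (simp add: r algebra_simps eval_nat_numeral)
    ultimately have "M + 1 dvd r ^ 4 - (-4)" by simp
    then have "M + 1 dvd (r ^ 4) ^ k - c"
      unfolding c_def by (rule dvd_trans[OF _ dvd_power_diff])
    moreover have "(r ^ 4) ^ k - s = ((r ^ 4) ^ k - c) - (s - c)" by simp
    ultimately show "M + 1 dvd (r ^ 4) ^ k - s" using sc by (metis dvd_diff)
  qed
  moreover have "coprime (M - 1) (M + 1)"
  proof (rule coprimeI)
    fix d assume d: "d dvd M - 1" "d dvd M + 1"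
    from \<open>k > 0\<close> have "even M" by (simp add: M_def)
    then have "odd (M + 1)" by simp
    then have "odd d" using d(2) dvd_trans by blast
    moreover have "d dvd 2" using dvd_diff[OF d(2,1)] by simp
    ultimately show "is_unit d"
      by (metis coprime_right_2_iff_odd coprime_common_divisor dvd_refl)
  qed
  ultimately have "(M - 1) * (M + 1) dvd (r ^ 4) ^ k - s"
    using divides_mult by blast
  then have N: "M * M - 1 dvd (r ^ 4) ^ k - s" by (simp add: algebra_simps)
  then show "16 ^ k * 16 ^ k - 1 dvd 1 + r + r ^ (4 * k)"
    unfolding s by (simp add: M_def)
  \<comment> \<open>As \<open>r ^ (4 * k)\<close> is \<open>s\<close> modulo
    \<open>M * M - 1\<close>, it remains to see that \<open>s ^ 4\<close> is
    \<open>1\<close>.\<close>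
  have "s - 1 = (M - 1) * (y + 1)"
    by (simp add: s_def algebra_simps)
  then have "(M - 1) * (M + 1) dvd (s - 1) * (s\<^sup>2 + 1) * (s + 1)"
    using s2 by (intro dvd_mult2 mult_dvd_mono) auto
  also have "(s - 1) * (s\<^sup>2 + 1) * (s + 1) = s ^ 4 - 1"
    by (simp add: algebra_simps eval_nat_numeral)
  finally have "M * M - 1 dvd s ^ 4 - 1" by (simp add: algebra_simps)
  moreover have "M * M - 1 dvd ((r ^ 4) ^ k) ^ 4 - s ^ 4"
    using N dvd_power_diff by (rule dvd_trans)
  moreover have "r ^ (16 * k) - 1 = (((r ^ 4) ^ k) ^ 4 - s ^ 4) + (s ^ 4 - 1)"
    by (simp flip: power_mult)
  ultimately show "16 ^ k * 16 ^ k - 1 dvd r ^ (16 * k) - 1"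
    unfolding M_def by (metis dvd_add)
qed


section \<open>Polynomials acting on sequences in an abelian group\<close>

context comm_group
begin

text \<open>The additive map from \<open>int poly\<close> sending the \<open>i\<close>-th power of
  the indeterminate to \<open>a i\<close>, in multiplicative notation.\<close>

definition poly_act :: "(nat \<Rightarrow> 'a) \<Rightarrow> int poly \<Rightarrow> 'a" where
  "poly_act a p = finprod G (\<lambda>i. a i [^] poly.coeff p i) {..Polynomial.degree p}"

lemma poly_act_eq:
  assumes "range a \<subseteq> carrier G" "Polynomial.degree p \<le> d"
  shows "poly_act a p = finprod G (\<lambda>i. a i [^] poly.coeff p i) {..d}"
  unfolding poly_act_def using assms
  by (intro finprod_mono_neutral_cong_left) (auto simp: coeff_eq_0)

lemma poly_act_closed [simp]: "range a \<subseteq> carrier G \<Longrightarrow> poly_act a p \<in> carrier G"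
  unfolding poly_act_def by (intro finprod_closed) auto

lemma poly_act_0 [simp]: "range a \<subseteq> carrier G \<Longrightarrow> poly_act a 0 = \<one>"
  by (auto simp: poly_act_def)

lemma poly_act_add:
  assumes "range a \<subseteq> carrier G"
  shows "poly_act a (p + q) = poly_act a p \<otimes> poly_act a q"
proof -
  define d where "d = max (Polynomial.degree p) (Polynomial.degree q)"
  have "a i \<in> carrier G" for i using assms by auto
  moreover have "Polynomial.degree (p + q) \<le> d" "Polynomial.degree p \<le> d" "Polynomial.degree q \<le> d"
    by (auto simp: d_def intro: degree_add_le)
  ultimately show ?thesis
    by (simp add: poly_act_eq[OF assms, of _ d] int_pow_mult Pi_def)
qed

lemma poly_act_minus:
  assumes "range a \<subseteq> carrier G"
  shows "poly_act a (- p) = inv (poly_act a p)"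
  using assms poly_act_add[OF assms, of "- p" p] by (simp add: inv_equality)

lemma poly_act_monom:
  assumes "range a \<subseteq> carrier G"
  shows "poly_act a (Polynomial.monom c j) = a j [^] c"
proof -
  have a: "a i \<in> carrier G" for i using assms by auto
  have "poly_act a (Polynomial.monom c j) =
      finprod G (\<lambda>i. if j = i then a i [^] c else \<one>) {..j}"
    unfolding poly_act_eq[OF assms degree_monom_le]
    by (intro finprod_cong') (auto simp: a)
  also have "\<dots> = a j [^] c"
    using finprod_singleton[of j "{..j}" "\<lambda>i. a i [^] c"] a by auto
  finally show ?thesis .
qed

lemma poly_act_pCons_0:
  assumes "range a \<subseteq> carrier G"
  shows "poly_act a (pCons 0 p) = poly_act (\<lambda>i. a (Suc i)) p"
proof -
  have a: "a i \<in> carrier G" for i using assms by auto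
  have "poly_act a (pCons 0 p) = finprod G (\<lambda>i. a i [^] poly.coeff (pCons 0 p) i) {..Suc (Polynomial.degree p)}"
    by (rule poly_act_eq[OF assms degree_pCons_le])
  also have "\<dots> = poly_act (\<lambda>i. a (Suc i)) p"
    unfolding poly_act_def by (subst finprod_Suc2) (auto simp: a)
  finally show ?thesis .
qed

text \<open>Quantifying over the shifts of the sequence makes the annihilator closed under
  multiplication by the indeterminate.\<close>

definition annihilator :: "(nat \<Rightarrow> 'a) \<Rightarrow> int poly set" where
  "annihilator a = {p. \<forall>k. poly_act (\<lambda>i. a (k + i)) p = \<one>}"

text \<open>Products are built along \<open>pCons\<close>: an integer factor is repeated addition or
  subtraction, and the indeterminate moves each shift of \<open>a\<close> to the next.\<close>

lemma ring_ideal_annihilator: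
  assumes "range a \<subseteq> carrier G"
  shows "ring_ideal (annihilator a)"
proof
  have a: "range (\<lambda>i. a (k + i)) \<subseteq> carrier G" for k using assms by auto
  show "0 \<in> annihilator a" by (simp add: annihilator_def a)
  show diff: "p - q \<in> annihilator a" if "p \<in> annihilator a" "q \<in> annihilator a" for p q
    using that poly_act_add[OF a, of _ p "- q"] by (simp add: annihilator_def poly_act_minus a)
  have add: "p + q \<in> annihilator a" if "p \<in> annihilator a" "q \<in> annihilator a" for p q
    using that by (simp add: annihilator_def poly_act_add a)
  have shift: "pCons 0 p \<in> annihilator a" if "p \<in> annihilator a" for p
  proof -
    have "poly_act (\<lambda>i. a (k + i)) (pCons 0 p) = poly_act (\<lambda>i. a (Suc k + i)) p" for k
      by (simp add: poly_act_pCons_0[OF a])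
    with that show ?thesis by (simp add: annihilator_def del: add_Suc)
  qed
  have scale: "Polynomial.smult c p \<in> annihilator a" if p: "p \<in> annihilator a" for c p
  proof (induction c rule: int_induct[of _ 0])
    case base
    show ?case by (simp add: annihilator_def a)
  next
    case (step1 i)
    then show ?case using add[OF _ p] by (simp add: smult_add_left)
  next
    case (step2 i)
    then show ?case using diff[OF _ p] by (simp add: smult_diff_left)
  qed
  show "p * q \<in> annihilator a" if p: "p \<in> annihilator a" for p q
  proof (induction q)
    case 0
    show ?case by (simp add: annihilator_def a)
  next
    case (pCons c q)
    then show ?case using add scale[OF p] shift by (simp add: mult_pCons_right)
  qed
qed

end


section \<open>Abelianized presentations\<close>

text \<open>The image of a word in the free abelian group, with generator \<open>j\<close> recorded
  as the \<open>j\<close>-th power of the indeterminate.\<close>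

definition word_poly :: "(nat \<times> bool) list \<Rightarrow> int poly" where
  "word_poly w = (\<Sum>(j, b)\<leftarrow>w. Polynomial.monom (if b then 1 else -1) j)"

lemma word_poly_Nil [simp]: "word_poly [] = 0"
  by (simp add: word_poly_def)

lemma word_poly_Cons:
  "word_poly ((j, b) # w) = Polynomial.monom (if b then 1 else -1) j + word_poly w"
  by (simp add: word_poly_def)

lemma word_poly_push: "word_poly (push_letter l w) = word_poly [l] + word_poly w"
proof (cases w)
  case (Cons m v)
  then show ?thesis
    by (cases l; cases m) (auto simp: word_poly_Cons inv_letter_def add_monom)
qed simp

text \<open>Cancelled letters contribute opposite monomials, so \<open>word_poly\<close> is additive
  on the free group.\<close>

lemma word_poly_foldr_push: "word_poly (foldr push_letter u v) = word_poly u + word_poly v"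
proof (induction u)
  case (Cons l u)
  then show ?case
    by (cases l) (simp add: word_poly_push word_poly_Cons add.assoc)
qed simp

text \<open>In a commutative target only the exponent sums of a word matter.\<close>

lemma hom_free_group_eq_poly_act:
  assumes "comm_group C" and h: "h \<in> hom (free_group S) C"
    and a: "range a \<subseteq> carrier C" and gen: "\<And>j. j \<in> S \<Longrightarrow> h (free_gen j) = a j"
    and w: "w \<in> carrier (free_group S)"
  shows "h w = comm_group.poly_act C a (word_poly w)"
proof -
  interpret C: comm_group C by fact
  interpret F: group "free_group S" by (rule group_free_group)
  interpret h: group_hom "free_group S" C h
    using h by unfold_locales
  show ?thesis using w
  proof (induction w)
    case Nil
    then show ?case using h.hom_one a by simp
  next
    case (Cons l w)
    obtain j b where l: "l = (j, b)" by force
    have red: "reduced (l # w)" and j: "j \<in> S"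
      using Cons.prems by (auto simp: carrier_free_group l)
    then have w: "w \<in> carrier (free_group S)"
      using Cons.prems by (cases w) (auto simp: carrier_free_group reduced_def)
    have lF: "[(j, b)] \<in> carrier (free_group S)" for b
      using j by (simp add: carrier_free_group reduced_def)
    have "[l] \<otimes>\<^bsub>free_group S\<^esub> w = l # w"
      using red w by (cases w) (auto simp: mult_free_group carrier_free_group reduced_def)
    then have *: "h (l # w) = h [l] \<otimes>\<^bsub>C\<^esub> h w"
      using h.hom_mult[OF lF w, of b] by (simp add: l)
    have "[(j, False)] \<otimes>\<^bsub>free_group S\<^esub> [(j, True)] = \<one>\<^bsub>free_group S\<^esub>"
      by (simp add: mult_free_group reduced_def inv_letter_def)
    then have "h [(j, False)] = inv\<^bsub>C\<^esub> h [(j, True)]"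
      using F.inv_equality h.hom_inv lF by metis
    moreover have aj: "a j \<in> carrier C" using a by auto
    ultimately have "h [l] = C.poly_act a (Polynomial.monom (if b then 1 else -1) j)"
      using gen[OF j] aj C.int_pow_neg[OF aj, of 1]
      by (auto simp: l free_gen_def C.poly_act_monom[OF a] C.int_pow_1[OF aj])
    with * Cons.IH[OF w] show ?case
      by (simp add: l word_poly_Cons C.poly_act_add[OF a])
  qed
qed

section \<open>Classes of words in an abelianized presentation, and their universal property\<close>

definition ab_class :: "'a set \<Rightarrow> ('a \<times> bool) list set \<Rightarrow> ('a \<times> bool) list \<Rightarrow> ('a \<times> bool) list set set"
  where "ab_class S R w =
    r_coset (presented_group S R) (derived (presented_group S R) (carrier (presented_group S R)))
      (r_coset (free_group S) (normal_closure (free_group S) R) w)"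

locale presentation =
  fixes S :: "'a set" and R
  assumes R: "R \<subseteq> carrier (free_group S)"
begin

abbreviation "F \<equiv> free_group S"
abbreviation "K \<equiv> normal_closure F R"
abbreviation "P \<equiv> presented_group S R"

sublocale F: group F by (rule group_free_group)
sublocale P: group P by (rule group_presented_group[OF R])
sublocale K: normal K F by (rule F.normal_closure_normal[OF R])
sublocale D: normal "derived P (carrier P)" P
  by (rule P.derived_self_is_normal)

lemma comm_group_abelianization: "comm_group (abelianization P)"
  unfolding abelianization_def by (rule P.derived_quot_is_comm_group)

lemma ab_class_hom: "ab_class S R \<in> hom F (abelianization P)"
proof -
  have "(\<lambda>x. derived P (carrier P) #>\<^bsub>P\<^esub> x) \<circ> (\<lambda>w. K #>\<^bsub>F\<^esub> w) \<in> hom F (abelianization P)"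
    using K.r_coset_hom_Mod D.r_coset_hom_Mod
    by (intro hom_compose) (auto simp: abelianization_def presented_group_def)
  then show ?thesis by (simp add: ab_class_def[abs_def] comp_def)
qed

lemma ab_class_surj: "ab_class S R ` carrier F = carrier (abelianization P)"
  by (auto simp: ab_class_def abelianization_def carrier_FactGroup presented_group_def image_image)

lemma ab_class_relator:
  assumes "r \<in> R"
  shows "ab_class S R r = \<one>\<^bsub>abelianization P\<^esub>"
proof -
  have "r \<in> K" using assms by (auto simp: normal_closure_def)
  then have "K #>\<^bsub>F\<^esub> r = \<one>\<^bsub>P\<^esub>"
    using F.coset_join2[OF _ K.is_subgroup] R assms by (auto simp: presented_group_def)
  then show ?thesis
    using P.coset_join2[OF _ D.is_subgroup] D.one_closed by (auto simp: ab_class_def abelianization_def)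
qed

text \<open>The kernel of \<open>h\<close> is normal and contains the relators, so \<open>h\<close>
  factors through \<open>P\<close>; as \<open>H\<close> is commutative, the induced map kills the
  derived subgroup and factors again.\<close>

lemma ab_class_universal:
  assumes "comm_group H" "h \<in> hom F H" and ker: "\<And>r. r \<in> R \<Longrightarrow> h r = \<one>\<^bsub>H\<^esub>"
  obtains g where "g \<in> hom (abelianization P) H"
    "\<And>w. w \<in> carrier F \<Longrightarrow> g (ab_class S R w) = h w"
proof -
  interpret H: comm_group H by fact
  interpret h: group_hom F H h using assms(2) by unfold_locales
  have "R \<subseteq> kernel F H h" using R ker by (auto simp: kernel_def)
  then have "K \<subseteq> kernel F H h"
    using h.normal_kernel by (auto simp: normal_closure_def)
  then obtain f where f: "f \<in> hom (F Mod K) H" "\<And>w. w \<in> carrier F \<Longrightarrow> f (K #>\<^bsub>F\<^esub> w) = h w"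
    using h.FactGroup_universal_kernel[OF K.normal_axioms] by blast
  then interpret f: group_hom P H f
    by unfold_locales (simp add: presented_group_def)
  have "f ` derived P (carrier P) = derived H (f ` carrier P)"
    by (rule f.derived_img[symmetric]) simp
  also have "\<dots> = {\<one>\<^bsub>H\<^esub>}"
    by (rule H.derived_eq_singleton) auto
  finally have "derived P (carrier P) \<subseteq> kernel P H f"
    using D.subset by (auto simp: kernel_def)
  then obtain g where g: "g \<in> hom (abelianization P) H"
    "\<And>x. x \<in> carrier P \<Longrightarrow> g (derived P (carrier P) #>\<^bsub>P\<^esub> x) = f x"
    using f.FactGroup_universal_kernel[OF D.normal_axioms] unfolding abelianization_def by blast
  show thesis
  proof (rule that[OF g(1)])
    fix w assume "w \<in> carrier F"
    moreover from this have "K #>\<^bsub>F\<^esub> w \<in> carrier P"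
      by (auto simp: presented_group_def carrier_FactGroup)
    ultimately show "g (ab_class S R w) = h w"
      using f(2) g(2) by (simp add: ab_class_def)
  qed
qed

text \<open>Every class comes from a word, so bijectivity of the map induced by \<open>h\<close> can
  be checked on words.\<close>

lemma abelianization_iso:
  assumes "comm_group H" "h \<in> hom F H" and ker: "\<And>r. r \<in> R \<Longrightarrow> h r = \<one>\<^bsub>H\<^esub>"
    and surj: "h ` carrier F = carrier H"
    and inj: "\<And>w. w \<in> carrier F \<Longrightarrow> h w = \<one>\<^bsub>H\<^esub> \<Longrightarrow> ab_class S R w = \<one>\<^bsub>abelianization P\<^esub>"
  shows "abelianization P \<cong> H"
proof -
  obtain g where g: "g \<in> hom (abelianization P) H"
    "\<And>w. w \<in> carrier F \<Longrightarrow> g (ab_class S R w) = h w"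
    using ab_class_universal[OF assms(1-3)] by blast
  interpret H: comm_group H by fact
  interpret A: comm_group "abelianization P" by (rule comm_group_abelianization)
  interpret g: group_hom "abelianization P" H g using g(1) by unfold_locales
  have "g ` carrier (abelianization P) = carrier H"
    unfolding surj[symmetric] ab_class_surj[symmetric] image_image using g(2) by simp
  moreover have "inj_on g (carrier (abelianization P))"
    unfolding g.inj_on_one_iff using inj g(2) by (auto simp flip: ab_class_surj)
  ultimately have "g \<in> iso (abelianization P) H"
    using g(1) by (simp add: iso_def bij_betw_def)
  then show ?thesis by (rule is_isoI)
qed

end


section \<open>Cyclically presented groups\<close>

text \<open>With \<open>t\<close> the indeterminate, the hypotheses say that
  \<open>t ^ n - 1\<close> and \<open>word_poly w\<close> generate the same ideal as
  \<open>t - r\<close> and \<open>N\<close>: \<open>root\<close> gives one inclusion,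
  \<open>ideal\<close> the other. The isomorphism is evaluation at \<open>r\<close> modulo
  \<open>N\<close>.\<close>

theorem abelianization_cyc_presented_group_iso_cyclic:
  fixes n N :: nat and r :: int
  assumes "n > 0" "N > 0" and w: "w \<in> carrier (free_group {..<n})"
    and root: "int N dvd r ^ n - 1" "int N dvd poly (word_poly w) r"
    and ideal: "\<And>I :: int poly set. ring_ideal I \<Longrightarrow> [:0, 1:] ^ n - 1 \<in> I \<Longrightarrow> word_poly w \<in> I \<Longrightarrow>
      [:0, 1:] - of_int r \<in> I \<and> of_nat N \<in> I"
  shows "abelianization (cyc_presented_group n w) \<cong> integer_mod_group N"
proof -
  define R where "R = (\<lambda>i. shift_word n i w) ` {..<n}"
  interpret presentation "{..<n}" R
    by unfold_locales (auto simp: R_def intro: shift_word_closed w)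
  interpret A: comm_group "abelianization P" by (rule comm_group_abelianization)
  interpret ab: group_hom F "abelianization P" "ab_class {..<n} R"
    using ab_class_hom by unfold_locales
  \<comment> \<open>The generators become an \<open>n\<close>-periodic sequence, so that shifting
    subscripts is shifting the sequence.\<close>
  define a where "a j = ab_class {..<n} R (free_gen (j mod n))" for j
  have a: "range (\<lambda>i. a (k + i)) \<subseteq> carrier (abelianization P)" for k
    using \<open>n > 0\<close> by (auto simp: a_def intro!: ab.hom_closed free_gen_closed)
  have a0: "range a \<subseteq> carrier (abelianization P)" using a[of 0] by simp
  have ab: "ab_class {..<n} R v = A.poly_act a (word_poly v)" if "v \<in> carrier F" for v
    by (rule hom_free_group_eq_poly_act[OF A.comm_group_axioms ab_class_hom a0 _ that])
      (simp add: a_def)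
  have shift: "A.poly_act a (word_poly (shift_word n k v)) = A.poly_act (\<lambda>i. a (k + i)) (word_poly v)"
    for k v
  proof (induction v)
    case (Cons l v)
    obtain j b where l: "l = (j, b)" by force
    have "word_poly (shift_word n k (l # v)) =
      Polynomial.monom (if b then 1 else -1) ((k + j) mod n) + word_poly (shift_word n k v)"
      by (simp add: l shift_word_def word_poly_Cons)
    then show ?case
      by (simp add: l word_poly_Cons Cons A.poly_act_add a0 a A.poly_act_monom) (simp add: a_def)
  qed (simp add: shift_word_def a a0)
  have "word_poly w \<in> A.annihilator a"
  proof -
    have "A.poly_act (\<lambda>i. a (k + i)) (word_poly w) = \<one>\<^bsub>abelianization P\<^esub>" for k
    proof -
      have mem: "shift_word n (k mod n) w \<in> R" using \<open>n > 0\<close> by (auto simp: R_def)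
      have "\<one>\<^bsub>abelianization P\<^esub> = A.poly_act a (word_poly (shift_word n (k mod n) w))"
        unfolding ab[OF subsetD[OF R mem], symmetric] by (rule ab_class_relator[OF mem, symmetric])
      also have "shift_word n (k mod n) w = shift_word n k w"
        by (simp add: shift_word_def mod_add_left_eq)
      finally show ?thesis by (simp add: shift)
    qed
    then show ?thesis by (simp add: A.annihilator_def)
  qed
  \<comment> \<open>This is the periodicity of \<open>a\<close>.\<close>
  moreover have "[:0, 1:] ^ n - 1 \<in> A.annihilator a"
  proof -
    have eq: "[:0, 1:] ^ n - 1 = Polynomial.monom (1::int) n + (- Polynomial.monom 1 0)"
      by (simp add: monom_altdef one_pCons)
    have "a k \<in> carrier (abelianization P)" for k using a0 by auto
    then have "A.poly_act (\<lambda>i. a (k + i)) ([:0, 1:] ^ n - 1) = \<one>\<^bsub>abelianization P\<^esub>" for k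
      unfolding eq A.poly_act_add[OF a] A.poly_act_minus[OF a] A.poly_act_monom[OF a]
      by (simp add: A.int_pow_1) (simp add: a_def)
    then show ?thesis by (simp add: A.annihilator_def)
  qed
  moreover have I: "ring_ideal (A.annihilator a)"
    by (rule A.ring_ideal_annihilator[OF a0])
  ultimately have gens: "[:0, 1:] - of_int r \<in> A.annihilator a" "of_nat N \<in> A.annihilator a"
    using ideal[OF I] by simp_all
  define h where "h v = poly (word_poly v) r mod int N" for v
  let ?H = "integer_mod_group N"
  have "comm_group ?H" by simp
  moreover have hom: "h \<in> hom F ?H"
    using \<open>N > 0\<close>
    by (intro homI) (auto simp: h_def carrier_integer_mod_group mult_free_group carrier_free_group
        word_poly_foldr_push mod_add_eq)
  moreover have "h v = \<one>\<^bsub>?H\<^esub>" if "v \<in> R" for v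
  proof -
    \<comment> \<open>Reducing subscripts modulo \<open>n\<close> thus does not change values, and
      the \<open>i\<close>-th relator evaluates to \<open>r ^ i\<close> times the value of
      \<open>w\<close>.\<close>
    have pow: "[r ^ (j mod n) = r ^ j] (mod int N)" for j
    proof -
      have "[r ^ n = 1] (mod int N)"
        using root(1) by (simp add: cong_iff_dvd_diff)
      then have "[(r ^ n) ^ (j div n) * r ^ (j mod n) = 1 ^ (j div n) * r ^ (j mod n)] (mod int N)"
        by (intro cong_mult cong_pow cong_refl)
      then show ?thesis by (simp add: cong_sym_eq flip: power_mult power_add)
    qed
    have "[poly (word_poly (shift_word n i v)) r = r ^ i * poly (word_poly v) r] (mod int N)" for i v
    proof (induction v)
      case (Cons l v)
      obtain j b where l: "l = (j, b)" by force
      have *: "shift_word n i (l # v) = ((i + j) mod n, b) # shift_word n i v"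
        by (simp add: l shift_word_def)
      have "[(if b then 1 else -1) * r ^ ((i + j) mod n) + poly (word_poly (shift_word n i v)) r =
          (if b then 1 else -1) * r ^ (i + j) + r ^ i * poly (word_poly v) r] (mod int N)"
        by (intro cong_add cong_mult cong_refl pow Cons)
      then show ?case
        unfolding * by (simp add: l word_poly_Cons poly_monom power_add algebra_simps)
    qed (simp add: shift_word_def)
    moreover obtain i where "v = shift_word n i w" using \<open>v \<in> R\<close> by (auto simp: R_def)
    ultimately have "[poly (word_poly v) r = r ^ i * poly (word_poly w) r] (mod int N)" by blast
    then have "int N dvd poly (word_poly v) r"
      using root(2) by (simp add: cong_dvd_iff)
    then show ?thesis by (simp add: h_def)
  qed
  moreover have "h ` carrier F = carrier ?H"
  proof -
    interpret h: group_hom F ?H h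
      by (intro group_hom.intro group_hom_axioms.intro F.is_group group_integer_mod_group hom)
    \<comment> \<open>Generator \<open>0\<close> goes to the class of \<open>r ^ 0 = 1\<close>,
      which generates the cyclic group.\<close>
    have gen: "free_gen 0 \<in> carrier F" using \<open>n > 0\<close> by (simp add: free_gen_closed)
    have "z \<in> h ` carrier F" if "z \<in> carrier ?H" for z
    proof
      have "h (free_gen 0 [^]\<^bsub>F\<^esub> z) = h (free_gen 0) [^]\<^bsub>?H\<^esub> z"
        by (rule h.hom_int_pow[OF gen])
      also have "\<dots> = z"
        using that \<open>N > 0\<close>
        by (simp add: int_pow_integer_mod_group carrier_integer_mod_group h_def free_gen_def
            word_poly_Cons mod_mult_right_eq)
      finally show "z = h (free_gen 0 [^]\<^bsub>F\<^esub> z)" by simp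
    qed (simp add: gen)
    then show ?thesis by (auto intro: h.hom_closed)
  qed
  moreover have "ab_class {..<n} R v = \<one>\<^bsub>abelianization P\<^esub>"
    if v: "v \<in> carrier F" and hv: "h v = \<one>\<^bsub>?H\<^esub>" for v
  proof -
    let ?c = "poly (word_poly v) r"
    interpret I: ring_ideal "A.annihilator a" by fact
    \<comment> \<open>Split \<open>word_poly v\<close> into a multiple of \<open>t - r\<close> and
      its value at \<open>r\<close>, a multiple of \<open>N\<close>; both annihilate
      \<open>a\<close>.\<close>
    have "poly (word_poly v - [:?c:]) r = 0" by simp
    then have "[:- r, 1:] dvd word_poly v - [:?c:]" by (simp only: poly_eq_0_iff_dvd)
    moreover have "[:- r, 1:] = [:0, 1:] - of_int r" by (simp add: of_int_poly)
    ultimately have 1: "word_poly v - [:?c:] \<in> A.annihilator a"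
      using gens(1) I.dvd_mem by metis
    have "int N dvd ?c" using hv by (simp add: h_def dvd_eq_mod_eq_0)
    then have "of_nat N dvd [:?c:]"
      by (simp add: of_nat_poly)
    then have 2: "[:?c:] \<in> A.annihilator a" using gens(2) I.dvd_mem by blast
    have "word_poly v \<in> A.annihilator a" using I.add_mem[OF 1 2] by simp
    then have "A.poly_act (\<lambda>i. a (0 + i)) (word_poly v) = \<one>\<^bsub>abelianization P\<^esub>"
      unfolding A.annihilator_def by blast
    then show ?thesis by (simp add: ab v)
  qed
  ultimately have "abelianization P \<cong> ?H" by (rule abelianization_iso)
  then show ?thesis by (simp add: cyc_presented_group_def R_def)
qed

section \<open>The words \<open>x_0 x_1 x_m\<close> with \<open>m = n/2\<close> and
  \<open>m = n/4\<close>\<close>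

lemma pos_word3_eq:
  "pos_word3 n a b c = [(a, True), (b, True), (c, True)]"
  by (simp add: pos_word3_def free_gen_def free_group_def reduce_def inv_letter_def)

theorem theorem4p9:
  fixes n :: nat
  assumes "n \<ge> 1" and "16 dvd n"
  shows "abelianization (cyc_presented_group n (pos_word3 n 0 1 (n div 2)))
           \<cong> abelianization (cyc_presented_group n (pos_word3 n 0 1 (n div 4)))
       \<and> abelianization (cyc_presented_group n (pos_word3 n 0 1 (n div 4)))
           \<cong> integer_mod_group (2 ^ (n div 2) - 1)"
proof -
  obtain k where n: "n = 16 * k" using \<open>16 dvd n\<close> by auto
  have "k > 0" "1 < n" using n \<open>n \<ge> 1\<close> by auto
  define N :: nat where "N = 2 ^ (8 * k) - 1"
  have half: "n div 2 = 8 * k" and quarter: "n div 4 = 4 * k" using n by auto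
  have "(2::nat) ^ 1 \<le> 2 ^ (8 * k)" using \<open>k > 0\<close> by (intro power_increasing) auto
  then have "N > 0" by (simp add: N_def)
  \<comment> \<open>This matches \<open>2 ^ (n div 2) - 1\<close> with the modulus
    \<open>16 ^ k * 16 ^ k - 1\<close> of the quarter case.\<close>
  have pow: "2 ^ (8 * k) = (16::'a::comm_ring_1) ^ k * 16 ^ k"
    by (simp add: power_mult flip: power_mult_distrib)
  have N: "of_nat N = (2 ^ (8 * k) - 1 :: 'a::comm_ring_1)"
    by (simp add: N_def of_nat_diff)
  have word: "pos_word3 n 0 1 m \<in> carrier (free_group {..<n})" if "m < n" for m
    unfolding pos_word3_def using that \<open>1 < n\<close>
    by (intro monoid.m_closed group.is_monoid group_free_group free_gen_closed) auto
  have word_poly: "word_poly (pos_word3 n 0 1 m) = 1 + [:0, 1:] + [:0, 1:] ^ m" for m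
    by (simp add: pos_word3_eq word_poly_Cons monom_altdef)
  have "abelianization (cyc_presented_group n (pos_word3 n 0 1 (n div 2))) \<cong> integer_mod_group N"
  proof (rule abelianization_cyc_presented_group_iso_cyclic[where r = "-2"])
    show "int N dvd (-2) ^ n - 1"
    proof -
      have "(2 ^ (8 * k) :: int) - 1 dvd (2 ^ (8 * k)) ^ 2 - 1 ^ 2" by (rule dvd_power_diff)
      then show ?thesis by (simp add: N n flip: power_mult)
    qed
    show "int N dvd poly (word_poly (pos_word3 n 0 1 (n div 2))) (-2)"
      unfolding word_poly by (simp add: half N)
  next
    fix I :: "int poly set"
    assume I: "ring_ideal I" "[:0, 1:] ^ n - 1 \<in> I" "word_poly (pos_word3 n 0 1 (n div 2)) \<in> I"
    show "[:0, 1:] - of_int (- 2) \<in> I \<and> of_nat N \<in> I"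
      using ring_ideal.half_shift[OF I(1), of "[:0, 1:]" "8 * k"] I(2) I(3)[unfolded word_poly] \<open>k > 0\<close>
      by (simp add: half N n)
  qed (use \<open>k > 0\<close> \<open>N > 0\<close> n word in auto)
  moreover have "abelianization (cyc_presented_group n (pos_word3 n 0 1 (n div 4))) \<cong> integer_mod_group N"
  proof -
    have "even ((16::int) ^ k - (-4) ^ k)" using \<open>k > 0\<close> by simp
    then obtain y :: int where y: "2 * y = 16 ^ k - (-4) ^ k" by (metis evenE)
    define r where "r = - (1 + 16 ^ k + (16 ^ k - 1) * y)"
    have root: "int N dvd 1 + r + r ^ (4 * k)"
      using quarter_shift_root(1)[OF y \<open>k > 0\<close>] by (simp add: N pow r_def)
    have ideal: "[:0, 1:] - of_int r \<in> I \<and> of_nat N \<in> I"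
      if "ring_ideal I" "[:0, 1:] ^ n - 1 \<in> I" "word_poly (pos_word3 n 0 1 (n div 4)) \<in> I"
      for I :: "int poly set"
      using ring_ideal.quarter_shift[OF that(1), of "[:0, 1:]" k y] that(2) that(3)[unfolded word_poly] \<open>k > 0\<close> y
      by (simp add: quarter N n pow r_def)
    show ?thesis
    proof (rule abelianization_cyc_presented_group_iso_cyclic[OF _ \<open>N > 0\<close> word _ _ ideal])
      show "int N dvd r ^ n - 1"
        using quarter_shift_root(2)[OF y \<open>k > 0\<close>] by (simp add: N pow n r_def)
      show "int N dvd poly (word_poly (pos_word3 n 0 1 (n div 4))) r"
        using root unfolding word_poly by (simp add: quarter)
    qed (use \<open>k > 0\<close> n in auto)
  qed
  \<comment> \<open>Reversing the second isomorphism, to chain it with the first, requires its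
    source to be a group.\<close>
  moreover have "group (abelianization (cyc_presented_group n (pos_word3 n 0 1 (n div 4))))"
    unfolding abelianization_def
    by (intro group.derived_quot_is_group group_cyc_presented_group word) (use n \<open>k > 0\<close> in auto)
  ultimately show ?thesis
    unfolding N_def half by (blast intro: group.iso_sym iso_trans)
qed

end
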